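(* Let $G$ be a non-elementary hyperbolic group with some fixed finite generating set $S$ (closed under inversion and not containing the identity). Then there exists $K\geq 1$ such that, for every integer $k\geq K$ and every $g\in G$ outside the ball of radius $4k$ (i.e. $|g|>4k$), we have $\kappa_k^{\mathcal{S}}(g)<0$.
   Context: $|g|$ is the word length of $g$ with respect to $S$, $d(g,h)=|h^{-1}g|$ is the left-invariant word metric, and $S_k=\{s\in G: |s|=k\}$. For $g\neq 1$ and $k\ge 1$, the $k$-spherical conjugation curvature is $$\kappa_k^{\mathcal{S}}(g)=\frac{|g|-\frac{1}{|S_k|}\sum_{s\in S_k}d(gs,s)}{|g|}.$$ A finitely generated group is hyperbolic (in the sense of Gromov) if with its word metric it is $\delta$-hyperbolic for some $\delta\ge 0$, i.e. $(x,y)_w\geq \min\{(x,z)_w,(y,z)_w\}-\delta$ for all points $x,y,z,w$, where $(p,q)_r=\frac12(d(p,r)+d(r,q)-d(p,q))$; this property does not depend on the finite generating set. It is non-elementary if it is not virtually cyclic (finite groups count as virtually cyclic). *)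

theory Defs
  imports Complex_Main "HOL-Algebra.Elementary_Groups"
begin

section \<open>Finite generating sets and the word metric\<close>

definition fin_sym_generating_set :: "('a, 'b) monoid_scheme \<Rightarrow> 'a set \<Rightarrow> bool" where
  "fin_sym_generating_set G S \<longleftrightarrow>
     finite S \<and> S \<subseteq> carrier G \<and> generate G S = carrier G \<and>
     (\<forall>s\<in>S. inv\<^bsub>G\<^esub> s \<in> S) \<and> \<one>\<^bsub>G\<^esub> \<notin> S"

text \<open>Words use letters of \<open>S\<close> only: for \<open>S\<close> closed under inversion these are all words over
  \<open>S\<close> and its inverses. The \<open>LEAST\<close> is attained on the whole carrier exactly when \<open>S\<close> generates;
  outside that situation the value is unspecified.\<close>

definition word_length :: "('a, 'b) monoid_scheme \<Rightarrow> 'a set \<Rightarrow> 'a \<Rightarrow> nat" where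
  "word_length G S g =
     (LEAST n. \<exists>ws. set ws \<subseteq> S \<and> length ws = n \<and> foldr (\<otimes>\<^bsub>G\<^esub>) ws \<one>\<^bsub>G\<^esub> = g)"

definition word_dist :: "('a, 'b) monoid_scheme \<Rightarrow> 'a set \<Rightarrow> 'a \<Rightarrow> 'a \<Rightarrow> nat" where
  "word_dist G S g h = word_length G S (inv\<^bsub>G\<^esub> h \<otimes>\<^bsub>G\<^esub> g)"

definition word_sphere :: "('a, 'b) monoid_scheme \<Rightarrow> 'a set \<Rightarrow> nat \<Rightarrow> 'a set" where
  "word_sphere G S k = {s \<in> carrier G. word_length G S s = k}"

section \<open>Spherical conjugation curvature\<close>

text \<open>Meaningful for \<open>g \<noteq> \<one>\<close> and nonempty spheres; otherwise division by zero yields a junk value.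
  In an infinite group with a finite generating set all spheres are finite and nonempty.\<close>

definition conj_curvature :: "('a, 'b) monoid_scheme \<Rightarrow> 'a set \<Rightarrow> nat \<Rightarrow> 'a \<Rightarrow> real" where
  "conj_curvature G S k g =
     (real (word_length G S g)
        - 1 / real (card (word_sphere G S k))
            * (\<Sum>s\<in>word_sphere G S k. real (word_dist G S (g \<otimes>\<^bsub>G\<^esub> s) s)))
     / real (word_length G S g)"

section \<open>Gromov hyperbolicity\<close>

text \<open>\<open>gromov_product d p q r\<close> is the product of \<open>p\<close> and \<open>q\<close> based at \<open>r\<close>.\<close>

definition gromov_product :: "('a \<Rightarrow> 'a \<Rightarrow> real) \<Rightarrow> 'a \<Rightarrow> 'a \<Rightarrow> 'a \<Rightarrow> real" where
  "gromov_product d p q r = 1/2 * (d p r + d r q - d p q)"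

definition gromov_hyperbolic :: "real \<Rightarrow> 'a set \<Rightarrow> ('a \<Rightarrow> 'a \<Rightarrow> real) \<Rightarrow> bool" where
  "gromov_hyperbolic \<delta> M d \<longleftrightarrow>
     (\<forall>x\<in>M. \<forall>y\<in>M. \<forall>z\<in>M. \<forall>w\<in>M.
        gromov_product d x y w \<ge> min (gromov_product d x z w) (gromov_product d y z w) - \<delta>)"

text \<open>Hyperbolicity does not depend on the finite generating set, so it is expressed through
  the word metric of the generating set at hand.\<close>

definition hyperbolic_group :: "('a, 'b) monoid_scheme \<Rightarrow> 'a set \<Rightarrow> bool" where
  "hyperbolic_group G S \<longleftrightarrow>
     (\<exists>\<delta>\<ge>0. gromov_hyperbolic \<delta> (carrier G) (\<lambda>x y. real (word_dist G S x y)))"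

text \<open>Finite index is finiteness of the set of right cosets (\<open>card\<close> would be \<open>0\<close> for infinite
  index). Finite groups qualify through the trivial subgroup.\<close>

definition virtually_cyclic :: "('a, 'b) monoid_scheme \<Rightarrow> bool" where
  "virtually_cyclic G \<longleftrightarrow>
     (\<exists>H. subgroup H G \<and> cyclic_group (G\<lparr>carrier := H\<rparr>) \<and> finite (rcosets\<^bsub>G\<^esub> H))"

end

theory Submission
  imports Defs "HOL-Real_Asymp.Real_Asymp"
begin

text \<open>
  Write \<open>\<delta>\<close> for the hyperbolicity constant and \<open>gp\<close> for the Gromov product based at \<open>\<one>\<close>. If
  \<open>|s| = k\<close> and \<open>|g| > 4k\<close>, two applications of the four-point condition give
  \<open>d(gs, s) \<ge> |g| + 2k - 2 gp s g - 2 gp s (inv g) - 2\<delta>\<close>, so it suffices that the average of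
  \<open>gp s x\<close> over the sphere is clearly below \<open>k/2\<close>. Elements \<open>s\<close> with \<open>gp s x \<ge> k/4\<close> lie in a ball
  of radius about \<open>3k/4\<close>, and these balls are negligible against the sphere of radius \<open>k\<close> because
  spheres grow exponentially, uniformly in the starting radius.

  For the growth, a hyperbolic element \<open>a\<close> whose powers have infinite index yields arbitrarily
  long tripods at \<open>\<one>\<close> with uniformly bounded Gromov products. From every group element \<open>g\<close> at
  least two legs of the translated tripod lead away from \<open>\<one>\<close>, which doubles any sufficiently
  separated subset of a sphere; separation persists because an element and its child lie almost
  on a common geodesic from \<open>\<one>\<close>.
\<close>

section \<open>Word length\<close>

locale word_metric_group = group G for G :: "('a, 'b) monoid_scheme" (structure) +
  fixes S :: "'a set"
  assumes generating: "fin_sym_generating_set G S"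
begin

abbreviation wl :: "'a \<Rightarrow> nat" where "wl \<equiv> word_length G S"

abbreviation word :: "'a list \<Rightarrow> 'a" where "word ws \<equiv> foldr (\<otimes>) ws \<one>"

lemma S_closed: "s \<in> S \<Longrightarrow> s \<in> carrier G"
  and S_inv: "s \<in> S \<Longrightarrow> inv s \<in> S"
  and S_finite: "finite S"
  and S_generates: "generate G S = carrier G"
  using generating by (auto simp: fin_sym_generating_set_def)

lemma word_closed: "set ws \<subseteq> S \<Longrightarrow> word ws \<in> carrier G"
  by (induction ws) (auto simp: S_closed)

lemma word_append:
  "set us \<subseteq> S \<Longrightarrow> set vs \<subseteq> S \<Longrightarrow> word (us @ vs) = word us \<otimes> word vs"
  by (induction us) (auto simp: S_closed word_closed m_assoc)

lemma word_inv:
  assumes "set ws \<subseteq> S"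
  shows "\<exists>vs. set vs \<subseteq> S \<and> length vs = length ws \<and> word vs = inv (word ws)"
  using assms
proof (induction ws)
  case (Cons s ws)
  then obtain vs where vs: "set vs \<subseteq> S" "length vs = length ws" "word vs = inv (word ws)"
    by auto
  have s: "s \<in> S" "set ws \<subseteq> S" using Cons.prems by auto
  have "word (vs @ [inv s]) = inv (word (s # ws))"
    using s vs S_inv[OF s(1)]
    by (subst word_append) (auto simp: word_closed S_closed inv_mult_group)
  then show ?case
    using vs s S_inv[OF s(1)] by (intro exI[of _ "vs @ [inv s]"]) auto
qed auto

lemma word_exists:
  assumes "g \<in> carrier G"
  shows "\<exists>ws. set ws \<subseteq> S \<and> word ws = g"
proof -
  have "g \<in> generate G S" using assms S_generates by simp
  then show ?thesis
  proof (induction rule: generate.induct)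
    case one
    show ?case by (rule exI[of _ "[]"]) simp
  next
    case (incl h)
    then show ?case by (intro exI[of _ "[h]"]) (simp add: S_closed)
  next
    case (inv h)
    then show ?case by (intro exI[of _ "[inv h]"]) (simp add: S_closed S_inv)
  next
    case (eng h1 h2)
    then obtain us vs where "set us \<subseteq> S" "word us = h1" "set vs \<subseteq> S" "word vs = h2" by blast
    then show ?case by (intro exI[of _ "us @ vs"]) (simp only: word_append, auto)
  qed
qed

lemma wl_le_length: "set ws \<subseteq> S \<Longrightarrow> wl (word ws) \<le> length ws"
  unfolding word_length_def by (rule Least_le) auto

lemma geodesic_word:
  assumes "g \<in> carrier G"
  obtains ws where "set ws \<subseteq> S" "length ws = wl g" "word ws = g"
proof -
  have "\<exists>n ws. set ws \<subseteq> S \<and> length ws = n \<and> word ws = g"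
    using word_exists[OF assms] by blast
  then have "\<exists>ws. set ws \<subseteq> S \<and> length ws = wl g \<and> word ws = g"
    unfolding word_length_def by (rule LeastI_ex)
  then show ?thesis using that by blast
qed

lemma wl_one [simp]: "wl \<one> = 0"
  using wl_le_length[of "[]"] by simp

lemma wl_mult:
  assumes "g \<in> carrier G" "h \<in> carrier G"
  shows "wl (g \<otimes> h) \<le> wl g + wl h"
proof -
  obtain us vs where "set us \<subseteq> S" "length us = wl g" "word us = g"
    "set vs \<subseteq> S" "length vs = wl h" "word vs = h"
    using geodesic_word assms by metis
  then show ?thesis using wl_le_length[of "us @ vs"] by (simp only: word_append) auto
qed

lemma wl_inv [simp]:
  assumes "g \<in> carrier G"
  shows "wl (inv g) = wl g"
proof -
  have le: "wl (inv h) \<le> wl h" if "h \<in> carrier G" for h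
    using geodesic_word[OF that] word_inv wl_le_length by metis
  show ?thesis using le[of g] le[of "inv g"] assms by simp
qed

lemma dist_sym:
  assumes "x \<in> carrier G" "y \<in> carrier G"
  shows "wl (inv y \<otimes> x) = wl (inv x \<otimes> y)"
  using wl_inv[of "inv x \<otimes> y"] assms by (simp add: inv_mult_group)

text \<open>A discrete intermediate value argument. Along a geodesic word for \<open>u\<close> the
  length of \<open>g\<close> times a prefix changes by at most one per letter, so the first prefix
  to reach \<open>t\<close> hits it exactly. Being a prefix of a geodesic makes the lengths of
  \<open>y\<close> and the remainder add up.\<close>

lemma path_reaches_sphere:
  assumes g: "g \<in> carrier G" and u: "u \<in> carrier G" and t: "wl g \<le> t" "t \<le> wl (g \<otimes> u)"
  obtains y where "y \<in> carrier G" "wl (g \<otimes> y) = t" "wl u = wl y + wl (inv y \<otimes> u)"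
proof -
  obtain ws where ws: "set ws \<subseteq> S" "length ws = wl u" "word ws = u"
    using geodesic_word[OF u] by metis
  have sub: "set (take m ws) \<subseteq> S" "set (drop m ws) \<subseteq> S" for m
    using ws(1) set_take_subset[of m ws] set_drop_subset[of m ws] by auto
  have closed: "word (take m ws) \<in> carrier G" for m
    using sub word_closed by blast
  define f where "f m = wl (g \<otimes> word (take m ws))" for m
  have ex: "t \<le> f (length ws)" using ws t by (simp add: f_def)
  define m where "m = (LEAST m. t \<le> f m)"
  have m: "t \<le> f m" unfolding m_def using ex by (rule LeastI)
  have mle: "m \<le> length ws" unfolding m_def using ex by (rule Least_le)
  have "f m \<le> t"
  proof (cases m)
    case 0
    then show ?thesis using t g by (simp add: f_def)
  next
    case (Suc j)
    have j: "f j < t" using not_less_Least[of j "\<lambda>m. t \<le> f m"] Suc by (simp add: m_def)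
    have lt: "j < length ws" using mle Suc by simp
    have s: "ws ! j \<in> S" using lt ws(1) by auto
    have "word (take m ws) = word (take j ws) \<otimes> ws ! j"
      using lt s sub S_closed[OF s] unfolding Suc take_Suc_conv_app_nth[OF lt]
      by (subst word_append) (auto simp del: foldr_append)
    then have "f m = wl ((g \<otimes> word (take j ws)) \<otimes> ws ! j)"
      using g closed S_closed[OF s] by (simp add: f_def m_assoc)
    also have "\<dots> \<le> f j + wl (ws ! j)"
      unfolding f_def using g closed S_closed[OF s] by (intro wl_mult) auto
    also have "wl (ws ! j) \<le> 1"
      using wl_le_length[of "[ws ! j]"] s S_closed[OF s] by simp
    finally show ?thesis using j by simp
  qed
  then have fm: "f m = t" using m by simp
  let ?y = "word (take m ws)"
  have "u = ?y \<otimes> word (drop m ws)"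
    using word_append[of "take m ws" "drop m ws"] sub ws(3) by (simp only: append_take_drop_id)
  then have "inv ?y \<otimes> u = word (drop m ws)"
    using inv_solve_left u closed sub word_closed by (metis inv_solve_left)
  then have "wl (inv ?y \<otimes> u) \<le> length ws - m"
    using wl_le_length[OF sub(2), of m] by simp
  moreover have "wl ?y \<le> m"
    using wl_le_length[OF sub(1), of m] mle by simp
  moreover have "wl u \<le> wl ?y + wl (inv ?y \<otimes> u)"
    using wl_mult[of ?y "inv ?y \<otimes> u"] closed u by (simp add: m_assoc[symmetric])
  ultimately have "wl u = wl ?y + wl (inv ?y \<otimes> u)" using ws(2) mle by linarith
  then show thesis using that[of ?y] fm closed by (simp add: f_def)
qed

lemma prefix_of_length:
  assumes "u \<in> carrier G" "t \<le> wl u"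
  obtains y where "y \<in> carrier G" "wl y = t" "wl u = t + wl (inv y \<otimes> u)"
  using path_reaches_sphere[of \<one> u t] assms by auto

section \<open>Finite balls and spheres\<close>

definition word_ball :: "nat \<Rightarrow> 'a set" where
  "word_ball n = {g \<in> carrier G. wl g \<le> n}"

lemma finite_word_ball [simp]: "finite (word_ball n)"
proof (rule finite_subset)
  show "word_ball n \<subseteq> word ` {ws. set ws \<subseteq> S \<and> length ws \<le> n}"
  proof
    fix g assume "g \<in> word_ball n"
    then have g: "g \<in> carrier G" "wl g \<le> n" by (auto simp: word_ball_def)
    obtain ws where "set ws \<subseteq> S" "length ws = wl g" "word ws = g"
      using geodesic_word[OF g(1)] by metis
    then show "g \<in> word ` {ws. set ws \<subseteq> S \<and> length ws \<le> n}" using g by force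
  qed
qed (use S_finite finite_lists_length_le in blast)

lemma finite_word_sphere [simp]: "finite (word_sphere G S n)"
  by (rule finite_subset[OF _ finite_word_ball[of n]]) (auto simp: word_sphere_def word_ball_def)

lemma card_word_ball: "card (word_ball n) = (\<Sum>j\<le>n. card (word_sphere G S j))"
proof -
  have "word_ball n = (\<Union>j\<in>{..n}. word_sphere G S j)"
    by (auto simp: word_ball_def word_sphere_def)
  then show ?thesis
    by (simp only:) (subst card_UN_disjoint, auto simp: word_sphere_def[abs_def] intro: finite_word_sphere[unfolded word_sphere_def])
qed

lemma word_length_unbounded:
  assumes "infinite (carrier G)"
  obtains g where "g \<in> carrier G" "wl g = n"
proof -
  have "\<not> carrier G \<subseteq> word_ball n"
    using assms finite_subset finite_word_ball by blast
  then obtain u where "u \<in> carrier G" "u \<notin> word_ball n" by blast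
  then have "u \<in> carrier G" "n \<le> wl u" by (auto simp: word_ball_def)
  then show thesis using prefix_of_length that by metis
qed

section \<open>Gromov products based at the identity\<close>

definition gp :: "'a \<Rightarrow> 'a \<Rightarrow> real" where
  "gp x y = (real (wl x) + real (wl y) - real (wl (inv x \<otimes> y))) / 2"

lemma gp_sym: "x \<in> carrier G \<Longrightarrow> y \<in> carrier G \<Longrightarrow> gp x y = gp y x"
  by (simp add: gp_def dist_sym)

lemma gp_le:
  assumes "x \<in> carrier G" "y \<in> carrier G"
  shows "gp x y \<le> wl x"
proof -
  have "wl y \<le> wl x + wl (inv x \<otimes> y)"
    using wl_mult[of x "inv x \<otimes> y"] assms by (simp add: m_assoc[symmetric])
  then show ?thesis by (simp add: gp_def)
qed

lemma wl_inv_mult: "real (wl (inv x \<otimes> y)) = wl x + wl y - 2 * gp x y"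
  by (simp add: gp_def field_simps)

lemma wl_mult_gp:
  assumes "x \<in> carrier G"
  shows "real (wl (x \<otimes> y)) = wl x + wl y - 2 * gp (inv x) y"
  using assms by (simp add: gp_def field_simps)

lemma gp_mult_self:
  assumes "x \<in> carrier G" "y \<in> carrier G"
  shows "gp (x \<otimes> y) x = (real (wl (x \<otimes> y)) + wl x - wl y) / 2"
proof -
  have "inv (x \<otimes> y) \<otimes> x = inv y"
    using assms by (simp add: inv_mult_group m_assoc)
  then show ?thesis using assms by (simp add: gp_def)
qed

text \<open>Moving from \<open>y\<close> along a geodesic to \<open>u\<close> increases the distance
  to \<open>x\<close> by at most the distance travelled, so Gromov products cannot decrease along a
  geodesic from \<open>\<one>\<close>.\<close>

lemma gp_mono_prefix:
  assumes x: "x \<in> carrier G" and y: "y \<in> carrier G" and u: "u \<in> carrier G"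
    and pre: "wl u = wl y + wl (inv y \<otimes> u)"
  shows "gp x y \<le> gp x u"
proof -
  have "inv x \<otimes> u = (inv x \<otimes> y) \<otimes> (inv y \<otimes> u)"
    using x y u by (simp add: m_assoc) (simp add: m_assoc[symmetric])
  then have "wl (inv x \<otimes> u) \<le> wl (inv x \<otimes> y) + wl (inv y \<otimes> u)"
    using wl_mult x y u by simp
  then show ?thesis using pre by (simp add: gp_def)
qed

end

section \<open>Hyperbolic elements\<close>

text \<open>Left invariance moves every base point to \<open>\<one>\<close>, so this is the
  four-point condition itself; with \<open>z\<close> in the middle the inequality reads as a chain
  from \<open>x\<close> to \<open>y\<close>.\<close>

locale hyperbolic_word_group = word_metric_group +
  fixes \<delta> :: real
  assumes \<delta>_nonneg: "0 \<le> \<delta>"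
    and gp_hyp: "x \<in> carrier G \<Longrightarrow> y \<in> carrier G \<Longrightarrow> z \<in> carrier G \<Longrightarrow>
      min (gp x z) (gp z y) \<le> gp x y + \<delta>"
begin

text \<open>The strict inequality excludes \<open>gp y z\<close> as the minimum in
  \<open>gp_hyp\<close>: if \<open>y\<close> and \<open>z\<close> travel together well beyond the
  point where \<open>x\<close> leaves \<open>y\<close>, then \<open>x\<close> leaves
  \<open>z\<close> at about the same point.\<close>

lemma gp_bound:
  assumes "x \<in> carrier G" "y \<in> carrier G" "z \<in> carrier G"
    and "gp x y \<le> c" "c + \<delta> < gp y z"
  shows "gp x z \<le> c + \<delta>"
  using gp_hyp[of x y z] gp_sym[of y z] assms by linarith

text \<open>If all squares were short, then every \<open>x\<close> would share about half of its length with
  \<open>inv x\<close>. For the two halves \<open>g\<close>, \<open>h\<close> of a long geodesic through \<open>\<one>\<close> the axes of \<open>g\<close> and \<open>h\<close>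
  then point into different directions, and the square of \<open>g \<otimes> h\<close> is long.\<close>

lemma exists_long_square:
  assumes inf: "infinite (carrier G)"
  obtains a where "a \<in> carrier G" "real (wl (a \<otimes> a)) > wl a + 4 * \<delta>"
proof (rule ccontr)
  assume "\<not> thesis"
  then have short: "real (wl (a \<otimes> a)) \<le> wl a + 4 * \<delta>" if "a \<in> carrier G" for a
    using that \<open>\<And>a. _ \<Longrightarrow> _ \<Longrightarrow> thesis\<close> by force
  \<comment> \<open>With this bound elements of length \<open>n\<close> have product above
    \<open>\<delta>\<close> with their inverse, and the later bound
    \<open>2 * n - 2 * \<delta>\<close> for the length of \<open>a\<close> exceeds
    \<open>10 * \<delta>\<close>, which gives the contradiction.\<close>
  obtain n :: nat where n: "real n > 6 * \<delta>" using reals_Archimedean2 by blast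
  obtain w where w: "w \<in> carrier G" "wl w = 2 * n" using word_length_unbounded[OF inf] by metis
  obtain v where v: "v \<in> carrier G" "wl v = n" "wl w = n + wl (inv v \<otimes> w)"
    using prefix_of_length[of w n] w by auto
  \<comment> \<open>The endpoints of the geodesic from \<open>\<one>\<close> to \<open>w\<close>,
    translated so that its midpoint \<open>v\<close> becomes \<open>\<one>\<close>.\<close>
  define g where "g = inv v"
  define h where "h = inv v \<otimes> w"
  have gc [simp]: "g \<in> carrier G" and hc [simp]: "h \<in> carrier G"
    using v w by (auto simp: g_def h_def)
  have len: "wl g = n" "wl h = n" using v w by (auto simp: g_def h_def)
  have "inv g \<otimes> h = w" using v w by (simp add: g_def h_def m_assoc[symmetric])
  then have gh0: "gp g h = 0" using len w by (simp add: gp_def)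
  have self: "\<delta> < gp x (inv x)" if "x \<in> carrier G" "wl x = n" for x
  proof -
    have "wl (inv x \<otimes> inv x) = wl (x \<otimes> x)"
      using wl_inv[of "x \<otimes> x"] that by (simp add: inv_mult_group)
    then show ?thesis using short[of x] that n by (simp add: gp_def)
  qed
  have 1: "gp h (inv g) \<le> \<delta>"
    using gp_bound[of h g "inv g" 0] gh0 gp_sym[of h g] self[of g] len by simp
  have 2: "gp g (inv h) \<le> \<delta>"
    using gp_bound[of g h "inv h" 0] gh0 self[of h] len by simp
  define a where "a = g \<otimes> h"
  have ac [simp]: "a \<in> carrier G" by (simp add: a_def)
  have ia: "inv a = inv h \<otimes> inv g" by (simp add: a_def inv_mult_group)
  have la: "real (wl a) \<ge> 2 * n - 2 * \<delta>"
    using wl_mult_gp[of g h] 1 gp_sym[of h "inv g"] len by (simp add: a_def)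
  have 3: "gp a g \<ge> n - \<delta>"
    using gp_mult_self[of g h] la len by (simp add: a_def)
  have 4: "gp (inv a) (inv h) \<ge> n - \<delta>"
    using gp_mult_self[of "inv h" "inv g"] la len wl_inv[OF ac] unfolding ia by simp
  have 5: "gp (inv h) a \<le> \<delta> + \<delta>"
    using gp_bound[of "inv h" g a \<delta>] 2 3 n gp_sym[of g "inv h"] gp_sym[of a g] \<delta>_nonneg by simp
  have 6: "gp a (inv a) \<le> (\<delta> + \<delta>) + \<delta>"
    using gp_bound[of a "inv h" "inv a" "\<delta> + \<delta>"] 4 5 n gp_sym[of "inv a" "inv h"]
      gp_sym[of a "inv h"] \<delta>_nonneg by simp
  have "wl (inv a \<otimes> inv a) = wl (a \<otimes> a)"
    using wl_inv[of "a \<otimes> a"] by (simp add: inv_mult_group)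
  then have "real (wl (a \<otimes> a)) \<ge> 2 * wl a - 6 * \<delta>"
    using 6 by (simp add: gp_def)
  then show False using short[of a] la n by simp
qed

text \<open>The induction step for powers, with \<open>b\<close> a power of \<open>a\<close>. A gain
  of \<open>\<eta>\<close> makes \<open>a\<close> and \<open>a \<otimes> b\<close> share more than
  half of \<open>a\<close>; since \<open>a\<close> and \<open>b\<close> commute, the same holds for
  the inverses. As \<open>a\<close> and \<open>inv a\<close> diverge earlier, so do \<open>a\<close>
  and \<open>inv (a \<otimes> b)\<close>, and the next factor gains \<open>\<eta>\<close> again. The
  \<open>2 * \<delta>\<close> subtracted in \<open>\<eta>\<close> pays for the single use of
  \<open>gp_bound\<close>, so the gain does not deteriorate.\<close>

lemma commuting_translate:
  fixes \<eta> :: real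
  assumes a: "a \<in> carrier G" and long: "real (wl (a \<otimes> a)) > wl a + 4 * \<delta>"
    and \<eta>: "\<eta> = real (wl (a \<otimes> a)) - wl a - 2 * \<delta>"
    and b: "b \<in> carrier G" and comm: "a \<otimes> b = b \<otimes> a"
    and inc: "real (wl (a \<otimes> b)) \<ge> wl b + \<eta>"
  shows "gp a (a \<otimes> b) \<ge> (wl a + \<eta>) / 2"
    and "gp (inv a) (inv (a \<otimes> b)) \<ge> (wl a + \<eta>) / 2"
    and "real (wl (a \<otimes> (a \<otimes> b))) \<ge> wl (a \<otimes> b) + \<eta>"
proof -
  define c where "c = a \<otimes> b"
  have c: "c \<in> carrier G" using a b by (simp add: c_def)
  show "gp a (a \<otimes> b) \<ge> (wl a + \<eta>) / 2"
    using gp_mult_self[OF a b] gp_sym[OF a m_closed[OF a b]] inc by simp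
  have ic: "inv c = inv a \<otimes> inv b" unfolding c_def comm by (rule inv_mult_group[OF b a])
  then have "gp (inv c) (inv a) = (real (wl c) + wl a - wl b) / 2"
    using gp_mult_self[of "inv a" "inv b"] a b wl_inv[OF c] by simp
  then have far: "gp (inv a) (inv c) \<ge> (wl a + \<eta>) / 2"
    using inc gp_sym[of "inv a" "inv c"] a c by (simp add: c_def)
  then show "gp (inv a) (inv (a \<otimes> b)) \<ge> (wl a + \<eta>) / 2"
    by (simp add: c_def)
  have "wl (inv a \<otimes> inv a) = wl (a \<otimes> a)"
    using wl_inv[of "a \<otimes> a"] a by (simp add: inv_mult_group)
  then have self: "gp a (inv a) = (wl a - \<eta>) / 2 - \<delta>"
    using a \<eta> by (simp add: gp_def field_simps)
  have "gp a (inv a) + \<delta> < gp (inv a) (inv c)"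
    using far self long \<eta> \<delta>_nonneg by (simp add: field_simps)
  then have "gp a (inv c) \<le> gp a (inv a) + \<delta>"
    using gp_bound[OF a inv_closed[OF a] inv_closed[OF c] order_refl] by blast
  then have "gp (inv c) a \<le> (wl a - \<eta>) / 2"
    using self gp_sym[OF a inv_closed[OF c]] by simp
  then have "real (wl (c \<otimes> a)) \<ge> wl c + \<eta>"
    using wl_mult_gp[OF c, of a] by (simp add: field_simps)
  moreover have "c \<otimes> a = a \<otimes> (a \<otimes> b)"
    unfolding c_def using m_assoc[OF a b a] comm by simp
  ultimately show "real (wl (a \<otimes> (a \<otimes> b))) \<ge> wl (a \<otimes> b) + \<eta>"
    by (simp add: c_def)
qed

lemma wl_pow_increment:
  fixes \<eta> :: real
  assumes a: "a \<in> carrier G" and long: "real (wl (a \<otimes> a)) > wl a + 4 * \<delta>"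
    and \<eta>: "\<eta> = real (wl (a \<otimes> a)) - wl a - 2 * \<delta>"
  shows "real (wl (a \<otimes> a [^] Suc n)) \<ge> wl (a [^] Suc n) + \<eta>"
proof (induction n)
  case 0
  then show ?case using a \<eta> \<delta>_nonneg by simp
next
  case (Suc n)
  have b: "a [^] Suc n \<in> carrier G" using a by (rule nat_pow_closed)
  have eq: "a [^] Suc (Suc n) = a \<otimes> a [^] Suc n" using a by (rule nat_pow_Suc2)
  have comm: "a \<otimes> a [^] Suc n = a [^] Suc n \<otimes> a" using eq by (simp only: nat_pow_Suc)
  show ?case unfolding eq by (rule commuting_translate(3)[OF a long \<eta> b comm Suc])
qed

lemma gp_pow_directions:
  fixes \<eta> :: real
  assumes a: "a \<in> carrier G" and long: "real (wl (a \<otimes> a)) > wl a + 4 * \<delta>"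
    and \<eta>: "\<eta> = real (wl (a \<otimes> a)) - wl a - 2 * \<delta>"
  shows "gp a (a [^] Suc n) \<ge> (wl a + \<eta>) / 2"
    and "gp (inv a) (inv (a [^] Suc n)) \<ge> (wl a + \<eta>) / 2"
proof -
  have \<eta>_le: "\<eta> \<le> wl a" using wl_mult[OF a a] \<eta> \<delta>_nonneg by simp
  have "gp a (a [^] Suc n) \<ge> (wl a + \<eta>) / 2 \<and> gp (inv a) (inv (a [^] Suc n)) \<ge> (wl a + \<eta>) / 2"
  proof (cases n)
    \<comment> \<open>The increment is available only from the first power on; here
      \<open>gp a a = wl a\<close> and \<open>\<eta>_le\<close> suffice.\<close>
    case 0
    then show ?thesis using a \<eta>_le by (simp add: gp_def)
  next
    case (Suc m)
    have b: "a [^] n \<in> carrier G" using a by (rule nat_pow_closed)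
    have eq: "a [^] Suc n = a \<otimes> a [^] n" using a by (rule nat_pow_Suc2)
    have comm: "a \<otimes> a [^] n = a [^] n \<otimes> a" using eq by (simp only: nat_pow_Suc)
    have "real (wl (a \<otimes> a [^] n)) \<ge> wl (a [^] n) + \<eta>"
      unfolding Suc by (rule wl_pow_increment[OF a long \<eta>])
    then show ?thesis
      unfolding eq using commuting_translate(1,2)[OF a long \<eta> b comm] by blast
  qed
  then show "gp a (a [^] Suc n) \<ge> (wl a + \<eta>) / 2"
    and "gp (inv a) (inv (a [^] Suc n)) \<ge> (wl a + \<eta>) / 2" by auto
qed

lemma wl_pow_unbounded:
  assumes a: "a \<in> carrier G" and long: "real (wl (a \<otimes> a)) > wl a + 4 * \<delta>"
  obtains n where "R \<le> wl (a [^] Suc n)"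
proof -
  have step: "wl (a [^] Suc n) < wl (a [^] Suc (Suc n))" for n
  proof -
    have eq: "a [^] Suc (Suc n) = a \<otimes> a [^] Suc n" using a by (rule nat_pow_Suc2)
    show ?thesis
      unfolding eq using wl_pow_increment[OF a long refl, of n] long \<delta>_nonneg by linarith
  qed
  have "n \<le> wl (a [^] Suc n)" for n
  proof (induction n)
    case (Suc n)
    then show ?case using step[of n] by linarith
  qed simp
  then show thesis using that by blast
qed

section \<open>Infinite index and tripods\<close>

lemma infinite_index_cyclic:
  assumes "a \<in> carrier G" "\<not> virtually_cyclic G"
  shows "infinite (rcosets (generate G {a}))"
proof -
  have "subgroup (generate G {a}) G" using assms by (intro generate_is_subgroup) auto
  moreover have "cyclic_group (G\<lparr>carrier := generate G {a}\<rparr>)"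
    using cyclic_group_generated[of a] assms by (simp add: subgroup_generated_def)
  ultimately show ?thesis using assms(2) unfolding virtually_cyclic_def by blast
qed

lemma infinite_carrier:
  assumes "\<not> virtually_cyclic G"
  shows "infinite (carrier G)"
proof
  assume "finite (carrier G)"
  then have "finite (rcosets (generate G {\<one>}))" by (simp add: RCOSETS_def)
  then show False using infinite_index_cyclic[OF one_closed assms] by simp
qed

text \<open>Only finitely many right cosets of the powers of \<open>a\<close> meet a ball, so
  infinite index leaves one outside the ball of radius \<open>R\<close>. A shortest element of such
  a coset is long and cannot be shortened by powers of \<open>a\<close>.\<close>

lemma exists_far_from_powers:
  assumes a: "a \<in> carrier G" and vc: "\<not> virtually_cyclic G"
  obtains g where "g \<in> carrier G" "R \<le> wl g"
    "\<And>n::nat. wl g \<le> wl (a [^] n \<otimes> g)" "\<And>n::nat. wl g \<le> wl (inv (a [^] n) \<otimes> g)"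
proof -
  let ?H = "generate G {a}"
  have H: "subgroup ?H G" using a by (intro generate_is_subgroup) auto
  have "\<exists>u\<in>carrier G. \<forall>m::int. R \<le> wl (a [^] m \<otimes> u)"
  proof (rule ccontr)
    assume "\<not> ?thesis"
    then have near: "\<exists>m::int. wl (a [^] m \<otimes> u) < R" if "u \<in> carrier G" for u
      using that by (auto simp: not_le)
    have "rcosets ?H \<subseteq> (\<lambda>v. ?H #> v) ` word_ball R"
    proof
      fix X assume "X \<in> rcosets ?H"
      then obtain u where u: "u \<in> carrier G" "X = ?H #> u" by (auto simp: RCOSETS_def)
      obtain m :: int where m: "wl (a [^] m \<otimes> u) < R" using near[OF u(1)] by blast
      have "a [^] m \<in> ?H" using generate_pow[OF a] by auto
      then have "a [^] m \<otimes> u \<in> ?H #> u" by (auto simp: r_coset_def)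
      then have "X = ?H #> (a [^] m \<otimes> u)" using repr_independence H u by metis
      then show "X \<in> (\<lambda>v. ?H #> v) ` word_ball R"
        using m a u by (auto simp: word_ball_def intro!: imageI)
    qed
    then have "finite (rcosets ?H)" by (rule finite_subset) simp
    then show False using infinite_index_cyclic[OF a vc] by simp
  qed
  then obtain u where u: "u \<in> carrier G" and far: "\<forall>m::int. R \<le> wl (a [^] m \<otimes> u)" by blast
  obtain m :: int where m: "\<forall>k::int. wl (a [^] m \<otimes> u) \<le> wl (a [^] k \<otimes> u)"
    using ex_has_least_nat[of "\<lambda>_. True" 0 "\<lambda>k::int. wl (a [^] k \<otimes> u)"] by auto
  define g where "g = a [^] m \<otimes> u"
  have shift: "a [^] k \<otimes> g = a [^] (k + m) \<otimes> u" for k :: int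
    using a u by (simp add: g_def int_pow_mult m_assoc)
  have min: "wl g \<le> wl (a [^] k \<otimes> g)" for k :: int
    unfolding shift using m by (simp add: g_def)
  show thesis
  proof (rule that)
    show "g \<in> carrier G" using a u by (simp add: g_def)
    show "R \<le> wl g" using far by (simp add: g_def)
    show "wl g \<le> wl (a [^] n \<otimes> g)" for n :: nat using min[of "int n"] by (simp add: int_pow_int)
    show "wl g \<le> wl (inv (a [^] n) \<otimes> g)" for n :: nat
      using min[of "- int n"] a by (simp add: int_pow_neg int_pow_int)
  qed
qed

definition tripod :: "real \<Rightarrow> nat \<Rightarrow> 'a \<Rightarrow> 'a \<Rightarrow> 'a \<Rightarrow> bool" where
  "tripod c R x y z \<longleftrightarrow> x \<in> carrier G \<and> y \<in> carrier G \<and> z \<in> carrier G \<and>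
     R \<le> wl x \<and> R \<le> wl y \<and> R \<le> wl z \<and> gp x y \<le> c \<and> gp x z \<le> c \<and> gp y z \<le> c"

text \<open>The legs are \<open>a [^] n\<close>, its inverse and an element that is shortest in its right coset of the
  powers of a hyperbolic element \<open>a\<close>; infinite index makes the third leg as long as desired.\<close>

lemma exists_tripods:
  assumes vc: "\<not> virtually_cyclic G"
  obtains c where "0 \<le> c" "\<And>R. \<exists>x y z. tripod c R x y z"
proof -
  obtain a where a: "a \<in> carrier G" and long: "real (wl (a \<otimes> a)) > wl a + 4 * \<delta>"
    using exists_long_square infinite_carrier[OF vc] by metis
  define \<eta> where \<eta>: "\<eta> = real (wl (a \<otimes> a)) - wl a - 2 * \<delta>"
  have \<eta>_gt: "\<eta> > 2 * \<delta>" using long \<eta> by simp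
  \<comment> \<open>Independent of \<open>R\<close>: products with \<open>a\<close> or
    \<open>inv a\<close> are at most \<open>wl a / 2\<close>, and passing to a power costs
    \<open>\<delta>\<close>.\<close>
  define c where "c = wl a / 2 + \<delta>"
  have "\<exists>x y z. tripod c R x y z" for R
  proof -
    obtain n where n: "R \<le> wl (a [^] Suc n)" using wl_pow_unbounded[OF a long] by metis
    define x where "x = a [^] Suc n"
    have x [simp]: "x \<in> carrier G" unfolding x_def using a by (rule nat_pow_closed)
    obtain g where g: "g \<in> carrier G" "R \<le> wl g"
      "\<And>n::nat. wl g \<le> wl (a [^] n \<otimes> g)" "\<And>n::nat. wl g \<le> wl (inv (a [^] n) \<otimes> g)"
      using exists_far_from_powers[OF a vc] by metis
    note dir = gp_pow_directions[OF a long \<eta>, of n, folded x_def]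
    have "wl (inv a \<otimes> inv a) = wl (a \<otimes> a)"
      using wl_inv[of "a \<otimes> a"] a by (simp add: inv_mult_group)
    then have self: "gp a (inv a) = (wl a - \<eta>) / 2 - \<delta>"
      using a \<eta> by (simp add: gp_def field_simps)
    have "gp a (inv x) \<le> gp a (inv a) + \<delta>"
      using gp_bound[of a "inv a" "inv x" "gp a (inv a)"] a self dir \<eta>_gt \<delta>_nonneg by auto
    then have ax: "gp (inv x) a \<le> (wl a - \<eta>) / 2"
      using self gp_sym[OF a inv_closed[OF x]] by linarith
    have "gp (inv x) x \<le> (wl a - \<eta>) / 2 + \<delta>"
      by (rule gp_bound[OF _ a _ ax]) (use dir \<eta>_gt \<delta>_nonneg in \<open>simp_all add: field_simps\<close>)
    then have 1: "gp x (inv x) \<le> c"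
      using gp_sym[of x "inv x"] \<eta>_gt \<delta>_nonneg by (simp add: c_def field_simps)
    \<comment> \<open>Minimality of \<open>g\<close>: multiplying by \<open>inv a\<close> does not
      shorten it. The margin \<open>\<eta> / 2 > \<delta>\<close> in \<open>dir\<close> then carries
      the bound from \<open>a\<close> to its power.\<close>
    have ga: "gp g a \<le> wl a / 2"
      using g(4)[of 1] gp_sym[of a g] a g(1) by (simp add: gp_def)
    have "gp g x \<le> c"
      unfolding c_def by (rule gp_bound[OF g(1) a x ga]) (use dir \<eta>_gt in \<open>simp add: field_simps\<close>)
    then have 2: "gp x g \<le> c" using gp_sym[of g x] g(1) by simp
    have ga': "gp g (inv a) \<le> wl a / 2"
      using g(3)[of 1] gp_sym[of "inv a" g] a g(1) by (simp add: gp_def)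
    have "gp g (inv x) \<le> c"
      unfolding c_def
      by (rule gp_bound[OF g(1) inv_closed[OF a] inv_closed[OF x] ga'])
        (use dir \<eta>_gt in \<open>simp add: field_simps\<close>)
    then have 3: "gp (inv x) g \<le> c" using gp_sym[of g "inv x"] g(1) by simp
    show ?thesis
      using 1 2 3 g n x unfolding tripod_def x_def[symmetric]
      by (intro exI[of _ x] exI[of _ "inv x"] exI[of _ g]) simp
  qed
  moreover have "0 \<le> c" using \<delta>_nonneg by (simp add: c_def)
  ultimately show thesis using that by blast
qed

section \<open>Growth of spheres\<close>

definition separated :: "real \<Rightarrow> 'a set \<Rightarrow> bool" where
  "separated D A \<longleftrightarrow> (\<forall>x\<in>A. \<forall>y\<in>A. x \<noteq> y \<longrightarrow> D < wl (inv x \<otimes> y))"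

text \<open>Two legs that both follow the way back from \<open>g\<close> to \<open>\<one>\<close>
  would follow each other, so at most one leg of the tripod moved to \<open>g\<close> does. Each of
  the others is cut where it meets the sphere of radius \<open>n + L\<close>; by
  \<open>gp_mono_prefix\<close> cutting does not raise the products.\<close>

lemma two_children:
  fixes c :: real
  assumes tripods: "\<And>R. \<exists>x y z. tripod c R x y z"
    and g: "g \<in> word_sphere G S n"
  shows "\<exists>p q. p \<in> word_sphere G S (n + L) \<and> q \<in> word_sphere G S (n + L) \<and>
    wl (inv g \<otimes> p) \<le> L + 2 * (c + \<delta>) \<and> wl (inv g \<otimes> q) \<le> L + 2 * (c + \<delta>) \<and>
    2 * real L - 2 * c \<le> wl (inv p \<otimes> q)"
proof -
  have gc: "g \<in> carrier G" and gn: "wl g = n" using g by (auto simp: word_sphere_def)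
  have ig: "inv g \<in> carrier G" using gc by simp
  \<comment> \<open>Backtracking costs at most \<open>2 * (c + \<delta>)\<close>, so such a leg
    still reaches the target sphere.\<close>
  obtain R :: nat where R: "real R \<ge> L + 2 * (c + \<delta>)" using real_arch_simple by blast
  obtain x y z where t: "tripod c R x y z" using tripods by blast
  have "\<exists>u v. u \<in> carrier G \<and> v \<in> carrier G \<and> R \<le> wl u \<and> R \<le> wl v \<and> gp u v \<le> c \<and>
    gp (inv g) u \<le> c + \<delta> \<and> gp (inv g) v \<le> c + \<delta>"
  proof -
    have "gp (inv g) x \<le> c + \<delta> \<or> gp (inv g) y \<le> c + \<delta>"
      "gp (inv g) x \<le> c + \<delta> \<or> gp (inv g) z \<le> c + \<delta>"
      "gp (inv g) y \<le> c + \<delta> \<or> gp (inv g) z \<le> c + \<delta>"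
      using t ig gp_hyp[of x y "inv g"] gp_hyp[of x z "inv g"] gp_hyp[of y z "inv g"]
        gp_sym[of "inv g" x] gp_sym[of "inv g" y]
      by (auto simp: tripod_def)
    then show ?thesis using t unfolding tripod_def by metis
  qed
  then obtain u v where uv: "u \<in> carrier G" "v \<in> carrier G" "R \<le> wl u" "R \<le> wl v" "gp u v \<le> c"
    "gp (inv g) u \<le> c + \<delta>" "gp (inv g) v \<le> c + \<delta>" by blast
  have descend: "\<exists>y. y \<in> carrier G \<and> wl (g \<otimes> y) = n + L \<and> wl w = wl y + wl (inv y \<otimes> w) \<and>
      wl y \<le> L + 2 * (c + \<delta>)" if w: "w \<in> carrier G" "R \<le> wl w" "gp (inv g) w \<le> c + \<delta>" for w
  proof -
    have "real (wl (g \<otimes> w)) \<ge> n + L" using wl_mult_gp[OF gc, of w] w R gn by simp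
    then have "n + L \<le> wl (g \<otimes> w)" by linarith
    then obtain y where y: "y \<in> carrier G" "wl (g \<otimes> y) = n + L" "wl w = wl y + wl (inv y \<otimes> w)"
      using path_reaches_sphere[OF gc w(1), of "n + L"] gn by auto
    have "gp (inv g) y \<le> c + \<delta>" using gp_mono_prefix[OF ig y(1) w(1) y(3)] w(3) by simp
    then have "wl y \<le> L + 2 * (c + \<delta>)" using wl_mult_gp[OF gc, of y] y(2) gn by simp
    then show ?thesis using y by blast
  qed
  obtain y where y: "y \<in> carrier G" "wl (g \<otimes> y) = n + L" "wl u = wl y + wl (inv y \<otimes> u)"
    "wl y \<le> L + 2 * (c + \<delta>)" using descend[OF uv(1,3,6)] by blast
  obtain z where z: "z \<in> carrier G" "wl (g \<otimes> z) = n + L" "wl v = wl z + wl (inv z \<otimes> v)"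
    "wl z \<le> L + 2 * (c + \<delta>)" using descend[OF uv(2,4,7)] by blast
  have "gp y z \<le> gp y v" by (rule gp_mono_prefix[OF y(1) z(1) uv(2) z(3)])
  also have "\<dots> = gp v y" by (rule gp_sym[OF y(1) uv(2)])
  also have "\<dots> \<le> gp v u" by (rule gp_mono_prefix[OF uv(2) y(1) uv(1) y(3)])
  also have "\<dots> \<le> c" using gp_sym[OF uv(2,1)] uv(5) by simp
  finally have yz: "gp y z \<le> c" .
  have "L \<le> wl y" "L \<le> wl z" using wl_mult[OF gc y(1)] wl_mult[OF gc z(1)] y z gn by auto
  then have far: "2 * real L - 2 * c \<le> wl (inv y \<otimes> z)" using yz wl_inv_mult[of y z] by simp
  have cancel: "inv g \<otimes> (g \<otimes> w) = w" if "w \<in> carrier G" for w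
    using gc that by (simp add: m_assoc[symmetric])
  have "inv (g \<otimes> y) \<otimes> (g \<otimes> z) = inv y \<otimes> z"
    using gc y z cancel[of z] by (simp add: inv_mult_group m_assoc)
  then show ?thesis
    using y z gc far cancel
    by (intro exI[of _ "g \<otimes> y"] exI[of _ "g \<otimes> z"]) (simp add: word_sphere_def)
qed

text \<open>\<open>D\<close> is chosen so that close children of different parents would force the
  parents within \<open>D\<close> of each other. The bound on \<open>L\<close> separates siblings
  and makes close children share a stretch longer than the parents' radius.\<close>

lemma separated_doubling:
  fixes c D :: real
  assumes tripods: "\<And>R. \<exists>x y z. tripod c R x y z" and c: "0 \<le> c"
    and D: "D = 2 * (c + \<delta>) + 4 * \<delta>" and L: "D + 2 * c < L"
    and A: "A \<subseteq> word_sphere G S n" "separated D A"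
  shows "\<exists>B. B \<subseteq> word_sphere G S (n + L) \<and> separated D B \<and> card B = 2 * card A"
proof -
  define kids where "kids g p q \<longleftrightarrow> p \<in> word_sphere G S (n + L) \<and> q \<in> word_sphere G S (n + L) \<and>
    wl (inv g \<otimes> p) \<le> L + 2 * (c + \<delta>) \<and> wl (inv g \<otimes> q) \<le> L + 2 * (c + \<delta>) \<and>
    2 * real L - 2 * c \<le> wl (inv p \<otimes> q)" for g p q
  have "\<forall>g\<in>A. \<exists>p q. kids g p q"
    using two_children[OF tripods, of _ n L] A(1) unfolding kids_def by blast
  then obtain p q where kids: "\<And>g. g \<in> A \<Longrightarrow> kids g (p g) (q g)" by metis
  have D0: "0 \<le> D" using c \<delta>_nonneg D by simp
  have Ac: "g \<in> carrier G" "wl g = n" if "g \<in> A" for g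
    using that A(1) by (auto simp: word_sphere_def)
  have fin: "finite A" using A(1) finite_subset finite_word_sphere by blast
  have sib: "D < wl (inv (p g) \<otimes> q g)" if "g \<in> A" for g
    using kids[OF that] L D0 c unfolding kids_def by linarith
  have cousins: "D < wl (inv h \<otimes> h')"
    if g: "g \<in> A" "g' \<in> A" "g \<noteq> g'" and h: "h = p g \<or> h = q g" and h': "h' = p g' \<or> h' = q g'"
    for g g' h h'
  proof (rule ccontr)
    assume close: "\<not> D < wl (inv h \<otimes> h')"
    have hc: "h \<in> carrier G" "wl h = n + L" and hg: "wl (inv g \<otimes> h) \<le> L + 2 * (c + \<delta>)"
      using kids[OF g(1)] h unfolding kids_def word_sphere_def by auto
    have hc': "h' \<in> carrier G" "wl h' = n + L" and hg': "wl (inv g' \<otimes> h') \<le> L + 2 * (c + \<delta>)"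
      using kids[OF g(2)] h' unfolding kids_def word_sphere_def by auto
    have 1: "gp g h \<ge> n - (c + \<delta>)" using hg hc Ac[OF g(1)] by (simp add: gp_def field_simps)
    have 2: "gp g' h' \<ge> n - (c + \<delta>)" using hg' hc' Ac[OF g(2)] by (simp add: gp_def field_simps)
    have 3: "gp h h' \<ge> n - (c + \<delta>)"
      using close hc hc' L D0 c \<delta>_nonneg by (simp add: gp_def field_simps)
    \<comment> \<open>The chain \<open>g\<close>, \<open>h\<close>, \<open>h'\<close>,
      \<open>g'\<close> takes two uses of hyperbolicity; doubling the total loss gives exactly
      \<open>D\<close>.\<close>
    have "gp g h' \<ge> n - (c + \<delta>) - \<delta>"
      using gp_hyp[of g h' h] 1 3 Ac[OF g(1)] hc hc' by linarith
    then have "gp g g' \<ge> n - (c + \<delta>) - 2 * \<delta>"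
      using gp_hyp[of g g' h'] 2 Ac[OF g(1)] Ac[OF g(2)] hc' gp_sym[of g' h'] \<delta>_nonneg by linarith
    then have "wl (inv g \<otimes> g') \<le> D"
      using wl_inv_mult[of g g'] Ac[OF g(1)] Ac[OF g(2)] D by (simp add: field_simps)
    moreover have "D < wl (inv g \<otimes> g')" using A(2) g unfolding separated_def by blast
    ultimately show False by linarith
  qed
  have pq_closed: "p g \<in> carrier G" "q g \<in> carrier G" if "g \<in> A" for g
    using kids[OF that] unfolding kids_def word_sphere_def by auto
  have sib': "D < wl (inv (q g) \<otimes> p g)" if "g \<in> A" for g
    using sib[OF that] dist_sym[of "p g" "q g"] pq_closed[OF that] by simp
  have distinct: "h \<noteq> h'" if "D < wl (inv h \<otimes> h')" "h \<in> carrier G" for h h'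
    using that D0 by auto
  have inj: "inj_on p A" "inj_on q A"
    using cousins distinct pq_closed unfolding inj_on_def by metis+
  have disj: "p ` A \<inter> q ` A = {}"
  proof (rule ccontr)
    assume "p ` A \<inter> q ` A \<noteq> {}"
    then obtain g g' where gg: "g \<in> A" "g' \<in> A" "p g = q g'" by auto
    then have "D < wl (inv (p g) \<otimes> q g')" using sib[of g] cousins[of g g'] by (cases "g = g'") auto
    then show False using gg distinct pq_closed by metis
  qed
  define B where "B = p ` A \<union> q ` A"
  have "card B = 2 * card A"
    unfolding B_def using fin inj disj by (simp add: card_Un_disjoint card_image)
  moreover have "B \<subseteq> word_sphere G S (n + L)"
    using kids unfolding B_def kids_def by blast
  moreover have "separated D B"
    unfolding separated_def
  proof (intro ballI impI)
    fix h h' assume hh: "h \<in> B" "h' \<in> B" "h \<noteq> h'"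
    then obtain g g' where g: "g \<in> A" "h = p g \<or> h = q g" "g' \<in> A" "h' = p g' \<or> h' = q g'"
      unfolding B_def by blast
    show "D < wl (inv h \<otimes> h')"
    proof (cases "g = g'")
      case True
      then show ?thesis using g hh(3) sib sib' by metis
    next
      case False
      then show ?thesis using g cousins by blast
    qed
  qed
  ultimately show ?thesis by blast
qed

text \<open>A separated subset of greatest cardinality cannot be enlarged, so every point of
  \<open>X\<close> is within \<open>D\<close> of it and translates of one ball cover
  \<open>X\<close>.\<close>

lemma maximal_separated:
  assumes X: "finite X" "X \<subseteq> carrier G" and D: "0 \<le> D" "D \<le> real m"
  obtains A where "A \<subseteq> X" "separated D A" "card X \<le> card A * card (word_ball m)"
proof -
  have "\<exists>A. (A \<subseteq> X \<and> separated D A) \<and> (\<forall>B. B \<subseteq> X \<and> separated D B \<longrightarrow> card B \<le> card A)"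
    by (rule ex_has_greatest_nat[of _ "{}" _ "Suc (card X)"])
      (auto simp: separated_def less_Suc_eq_le intro: card_mono[OF X(1)])
  then obtain A where A: "A \<subseteq> X" "separated D A"
    and max: "\<And>B. B \<subseteq> X \<Longrightarrow> separated D B \<Longrightarrow> card B \<le> card A" by blast
  have fin: "finite A" using A X finite_subset by blast
  have "X \<subseteq> (\<lambda>(a, u). a \<otimes> u) ` (A \<times> word_ball m)"
  proof
    fix x assume x: "x \<in> X"
    have "\<exists>a\<in>A. wl (inv a \<otimes> x) \<le> D"
    proof (rule ccontr)
      assume "\<not> ?thesis"
      then have far: "D < wl (inv a \<otimes> x)" if "a \<in> A" for a using that by (auto simp: not_le)
      have far': "D < wl (inv x \<otimes> a)" if "a \<in> A" for a
      proof -
        have "a \<in> carrier G" "x \<in> carrier G" using that A X x by auto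
        then show ?thesis using far[OF that] dist_sym[of a x] by simp
      qed
      show False
      proof (cases "x \<in> A")
        case True
        then show False using far[OF True] D(1) x X by auto
      next
        case False
        have "separated D (insert x A)"
          using A(2) far far' unfolding separated_def by auto
        then have "card (insert x A) \<le> card A" using max A x by simp
        then show False using False fin by simp
      qed
    qed
    then obtain a where a: "a \<in> A" "wl (inv a \<otimes> x) \<le> D" by blast
    have "a \<in> carrier G" "x \<in> carrier G" using a A X x by auto
    then have "x = a \<otimes> (inv a \<otimes> x)" "inv a \<otimes> x \<in> carrier G" by (auto simp: m_assoc[symmetric])
    moreover have "wl (inv a \<otimes> x) \<le> m" using a(2) D(2) by linarith
    then have "inv a \<otimes> x \<in> word_ball m" using calculation by (simp add: word_ball_def)
    ultimately show "x \<in> (\<lambda>(a, u). a \<otimes> u) ` (A \<times> word_ball m)"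
      using a(1) by (intro image_eqI[of _ _ "(a, inv a \<otimes> x)"]) auto
  qed
  then have "card X \<le> card (A \<times> word_ball m)"
    using fin by (intro surj_card_le) auto
  then show thesis using that A by (simp add: card_cartesian_product)
qed

text \<open>All doublings advance by \<open>L\<close> except the last, which absorbs what remains of
  \<open>i\<close>.\<close>

lemma separated_growth:
  fixes c D :: real
  assumes tripods: "\<And>R. \<exists>x y z. tripod c R x y z" and c: "0 \<le> c"
    and D: "D = 2 * (c + \<delta>) + 4 * \<delta>" and L: "D + 2 * c < L"
    and "A \<subseteq> word_sphere G S n" "separated D A" "Suc q * L \<le> i"
  shows "\<exists>B. B \<subseteq> word_sphere G S (n + i) \<and> card B = 2 ^ Suc q * card A"
  using assms(5-)
proof (induction q arbitrary: n A i)
  case 0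
  then have "D + 2 * c < i" using L by simp
  then show ?case using separated_doubling[OF tripods c D _ 0(1,2), of i] by auto
next
  case (Suc q)
  obtain B where B: "B \<subseteq> word_sphere G S (n + L)" "separated D B" "card B = 2 * card A"
    using separated_doubling[OF tripods c D L Suc.prems(1,2)] by blast
  have "Suc q * L \<le> i - L" "L \<le> i" using Suc.prems(3) by auto
  then show ?case using Suc.IH[OF B(1,2), of "i - L"] B(3) by (simp add: mult.assoc)
qed

text \<open>A maximal separated subset is smaller than its sphere by at most the constant factor
  \<open>M\<close>, a ball size. Since \<open>M\<close> does not depend on \<open>n\<close>, the
  estimate can be summed over all spheres in a ball.\<close>

lemma sphere_growth:
  assumes vc: "\<not> virtually_cyclic G"
  obtains L M :: nat where "0 < L" "0 < M"
    "\<And>n q i. Suc q * L \<le> i \<Longrightarrow>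
      2 ^ Suc q * card (word_sphere G S n) \<le> M * card (word_sphere G S (n + i))"
proof -
  obtain c where c: "0 \<le> c" and tripods: "\<And>R. \<exists>x y z. tripod c R x y z"
    using exists_tripods[OF vc] by metis
  define D where "D = 2 * (c + \<delta>) + 4 * \<delta>"
  have D0: "0 \<le> D" using c \<delta>_nonneg by (simp add: D_def)
  obtain L :: nat where L: "D + 2 * c < L" using reals_Archimedean2 by blast
  obtain m :: nat where m: "D \<le> m" using real_arch_simple by blast
  have "2 ^ Suc q * card (word_sphere G S n)
      \<le> card (word_ball m) * card (word_sphere G S (n + i))" if qi: "Suc q * L \<le> i" for n q i
  proof -
    obtain A where A: "A \<subseteq> word_sphere G S n" "separated D A"
      "card (word_sphere G S n) \<le> card A * card (word_ball m)"
      using maximal_separated[OF finite_word_sphere _ D0 m, of n]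
      by (auto simp: word_sphere_def)
    obtain B where B: "B \<subseteq> word_sphere G S (n + i)" "card B = 2 ^ Suc q * card A"
      using separated_growth[OF tripods c D_def L A(1,2) qi] by blast
    have "2 ^ Suc q * card (word_sphere G S n) \<le> 2 ^ Suc q * (card A * card (word_ball m))"
      using A(3) by (rule mult_le_mono2)
    also have "\<dots> = card (word_ball m) * card B" using B(2) by simp
    also have "\<dots> \<le> card (word_ball m) * card (word_sphere G S (n + i))"
      using B(1) by (intro mult_le_mono2 card_mono) auto
    finally show ?thesis .
  qed
  moreover have "0 < L" using L c D0 by (cases L) auto
  moreover have "\<one> \<in> word_ball m" by (simp add: word_ball_def)
  then have "0 < card (word_ball m)" by (auto simp: card_gt_0_iff)
  ultimately show thesis using that by blast
qed

text \<open>The ball consists of at most \<open>k + 1\<close> spheres, each about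
  \<open>k / 4\<close> short of radius \<open>k\<close>; the exponential gain over that distance
  beats the linear number of spheres.\<close>

lemma ball_sphere_ratio:
  assumes vc: "\<not> virtually_cyclic G"
  obtains K :: nat where
    "\<And>k. K \<le> k \<Longrightarrow> 8 * card (word_ball (k - k div 4 + e)) \<le> card (word_sphere G S k)"
proof -
  obtain L M :: nat where LM: "0 < L" "0 < M" and growth: "\<And>n q i. Suc q * L \<le> i \<Longrightarrow>
      2 ^ Suc q * card (word_sphere G S n) \<le> M * card (word_sphere G S (n + i))"
    using sphere_growth[OF vc] by metis
  \<comment> \<open>The two subtracted ones allow for rounding in the divisions by 4 and by
    \<open>L\<close>.\<close>
  have "eventually (\<lambda>k::nat. 8 * (real k + 1) * M \<le> 2 powr ((k / 4 - 1 - e) / L - 1)) at_top"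
  proof -
    define l where "l = real L"
    have "l > 0" using LM by (simp add: l_def)
    then show ?thesis unfolding l_def[symmetric] by real_asymp
  qed
  then obtain K :: nat where
    K: "\<And>k. K \<le> k \<Longrightarrow> 8 * (real k + 1) * M \<le> 2 powr ((k / 4 - 1 - e) / L - 1)"
    unfolding eventually_at_top_linorder by blast
  show thesis
  proof (rule that[of K])
    fix k assume "K \<le> k"
    define r where "r = (k div 4 - e) div L"
    have "(k / 4 - 1 - e) / L - 1 \<le> real r"
    proof -
      have "real k / 4 - 1 \<le> real (k div 4)" by linarith
      then have 1: "real k / 4 - 1 - e \<le> real (k div 4 - e)" by linarith
      have "k div 4 - e < L * Suc r"
        unfolding r_def using LM(1) by (metis dividend_less_times_div mult_Suc_right add.commute)
      then have "real (k div 4 - e) \<le> L * (real r + 1)"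
        by (metis less_imp_le of_nat_Suc of_nat_le_iff of_nat_mult add.commute)
      then have "real k / 4 - 1 - e \<le> L * (real r + 1)" using 1 by linarith
      then have "(real k / 4 - 1 - e) / L \<le> real r + 1"
        using LM(1) by (simp add: pos_divide_le_eq mult.commute)
      then show ?thesis by simp
    qed
    then have "2 powr ((k / 4 - 1 - e) / L - 1) \<le> 2 powr real r" by (intro powr_mono) auto
    then have "8 * (real k + 1) * M \<le> 2 ^ r"
      using K[OF \<open>K \<le> k\<close>] by (simp add: powr_realpow)
    then have "real (8 * (k + 1) * M) \<le> real (2 ^ r)" by (simp add: algebra_simps)
    then have pow: "8 * (k + 1) * M \<le> 2 ^ r" by (simp only: of_nat_le_iff)
    have "8 * 1 * 1 \<le> 8 * (k + 1) * M" using LM(2) by (intro mult_le_mono) auto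
    then have "8 \<le> (2 :: nat) ^ r" using pow by linarith
    \<comment> \<open>\<open>growth\<close> needs at least one doubling. This also makes the
      truncated difference \<open>k div 4 - e\<close> positive, so the ball has radius below
      \<open>k\<close>.\<close>
    then have "r \<noteq> 0" by (intro notI) simp
    then obtain q where q: "r = Suc q" using not0_implies_Suc by blast
    have qL: "Suc q * L \<le> k div 4 - e" unfolding q[symmetric] r_def by simp
    then have "0 < k div 4 - e" using LM(1) by (metis less_le_trans mult_pos_pos zero_less_Suc)
    define N where "N = k - k div 4 + e"
    have N: "N \<le> k" "k - N = k div 4 - e"
      using \<open>0 < k div 4 - e\<close> by (auto simp: N_def)
    have "2 ^ r * card (word_ball N) = (\<Sum>j\<le>N. 2 ^ r * card (word_sphere G S j))"
      by (simp add: card_word_ball sum_distrib_left)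
    also have "\<dots> \<le> (\<Sum>j\<le>N. M * card (word_sphere G S k))"
    proof (rule sum_mono)
      fix j assume "j \<in> {..N}"
      then have "Suc q * L \<le> k - j" "j + (k - j) = k" using qL N by auto
      then show "2 ^ r * card (word_sphere G S j) \<le> M * card (word_sphere G S k)"
        using growth[of q "k - j" j] q by simp
    qed
    also have "\<dots> \<le> (k + 1) * (M * card (word_sphere G S k))" using N by simp
    finally have "8 * (k + 1) * M * card (word_ball N) \<le> (k + 1) * (M * card (word_sphere G S k))"
      using mult_le_mono1[OF pow, of "card (word_ball N)"] by linarith
    then have "((k + 1) * M) * (8 * card (word_ball N)) \<le> ((k + 1) * M) * card (word_sphere G S k)"
      by (simp only: mult_ac)
    then show "8 * card (word_ball (k - k div 4 + e)) \<le> card (word_sphere G S k)"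
      using LM(2) by (simp add: N_def)
  qed
qed

section \<open>Averaging over a sphere\<close>

text \<open>As \<open>g\<close> is long, \<open>g \<otimes> s\<close> follows \<open>g\<close> for
  at least \<open>k\<close>, while \<open>s\<close> has length only \<open>k\<close>. So the minimum
  in the four-point condition is \<open>gp s (g \<otimes> s)\<close>, which is thereby bounded
  through \<open>gp s g\<close>.\<close>

lemma wl_conjugate_ge:
  assumes g: "g \<in> carrier G" and s: "s \<in> carrier G" "wl s = k" and long: "4 * k < wl g"
  shows "real (wl (inv s \<otimes> (g \<otimes> s))) \<ge> wl g + 2 * k - 2 * gp s g - 2 * gp s (inv g) - 2 * \<delta>"
proof -
  have gs: "real (wl (g \<otimes> s)) = wl g + k - 2 * gp s (inv g)"
    using wl_mult_gp[OF g, of s] gp_sym[of s "inv g"] g s by simp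
  have "gp s (inv g) \<le> k" using gp_le[of s "inv g"] g s by simp
  then have "gp (g \<otimes> s) g \<ge> k"
    using gp_mult_self[OF g s(1)] gs s long by simp
  moreover have "gp s (g \<otimes> s) \<le> k" using gp_le[of s "g \<otimes> s"] g s by simp
  ultimately have "gp s (g \<otimes> s) \<le> gp s g + \<delta>"
    using gp_hyp[of s g "g \<otimes> s"] g s by simp
  then show ?thesis using wl_inv_mult[of s "g \<otimes> s"] gs s by simp
qed

text \<open>All these elements pass near the point \<open>y\<close> at distance \<open>t\<close> on
  a geodesic to \<open>x\<close>, hence lie in one ball around \<open>y\<close>; \<open>e\<close>
  absorbs the error \<open>2 * \<delta>\<close>.\<close>

lemma card_shadow_le:
  assumes x: "x \<in> carrier G" and t: "t \<le> wl x" "t \<le> k" and e: "2 * \<delta> \<le> real e"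
  shows "card {s \<in> word_sphere G S k. t \<le> gp s x} \<le> card (word_ball (k - t + e))"
proof -
  obtain y where y: "y \<in> carrier G" "wl y = t" "wl x = t + wl (inv y \<otimes> x)"
    using prefix_of_length[OF x t(1)] by blast
  have yx: "gp y x = t" using y by (simp add: gp_def)
  have "{s \<in> word_sphere G S k. t \<le> gp s x} \<subseteq> (\<otimes>) y ` word_ball (k - t + e)"
  proof
    fix s assume "s \<in> {s \<in> word_sphere G S k. t \<le> gp s x}"
    then have s: "s \<in> carrier G" "wl s = k" "t \<le> gp s x" by (auto simp: word_sphere_def)
    have "gp y s \<ge> t - \<delta>"
      using gp_hyp[of y s x] gp_sym[of s x] yx s x y by simp
    then have "real (wl (inv y \<otimes> s)) \<le> real k - t + 2 * \<delta>"
      using wl_inv_mult[of y s] s y by simp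
    then have "real (wl (inv y \<otimes> s)) \<le> real (k - t + e)"
      using e t(2) by (simp add: of_nat_diff)
    then have "inv y \<otimes> s \<in> word_ball (k - t + e)"
      using s y by (simp add: word_ball_def del: of_nat_add)
    moreover have "s = y \<otimes> (inv y \<otimes> s)" using s y by (simp add: m_assoc[symmetric])
    ultimately show "s \<in> (\<otimes>) y ` word_ball (k - t + e)" by blast
  qed
  then show ?thesis by (meson card_image_le card_mono finite_imageI finite_word_ball le_trans)
qed

text \<open>Products below \<open>k div 4\<close> contribute at most \<open>k / 4\<close> each; the
  others, at most an eighth of the sphere, contribute at most \<open>k\<close> each. The sum 1/4 +
  1/8 = 3/8 stays below the critical 1/2.\<close>

lemma sum_gp_le:
  assumes x: "x \<in> carrier G" and t: "k div 4 \<le> wl x" and e: "2 * \<delta> \<le> real e"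
    and ratio: "8 * card (word_ball (k - k div 4 + e)) \<le> card (word_sphere G S k)"
  shows "(\<Sum>s\<in>word_sphere G S k. gp s x) \<le> 3 / 8 * k * card (word_sphere G S k)"
proof -
  let ?X = "word_sphere G S k" and ?t = "k div 4"
  let ?B = "{s \<in> ?X. real ?t \<le> gp s x}"
  have "(\<Sum>s\<in>?X. gp s x) \<le> (\<Sum>s\<in>?X. real k / 4 + (if s \<in> ?B then real k else 0))"
  proof (rule sum_mono)
    fix s assume s: "s \<in> ?X"
    have "gp s x \<le> k" using s gp_le[of s x] x by (auto simp: word_sphere_def)
    moreover have "real ?t \<le> real k / 4" by linarith
    ultimately show "gp s x \<le> real k / 4 + (if s \<in> ?B then real k else 0)"
      using s by auto
  qed
  also have "\<dots> = real k / 4 * card ?X + real k * card ?B"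
  proof -
    have "?X \<inter> {s. s \<in> ?B} = ?B" by blast
    then show ?thesis
      by (simp only: sum.distrib sum.If_cases[OF finite_word_sphere]) (simp add: mult.commute)
  qed
  also have "\<dots> \<le> real k / 4 * card ?X + real k * (card ?X / 8)"
  proof -
    have "8 * card ?B \<le> card ?X"
      using card_shadow_le[OF x t _ e, of k] ratio by simp
    then have "real (card ?B) \<le> card ?X / 8" by linarith
    then show ?thesis by (intro add_left_mono mult_left_mono) auto
  qed
  finally show ?thesis by (simp add: algebra_simps)
qed

lemma eventually_negative_curvature:
  assumes vc: "\<not> virtually_cyclic G"
  shows "\<exists>K::nat. K \<ge> 1 \<and>
    (\<forall>k\<ge>K. \<forall>g\<in>carrier G. wl g > 4 * k \<longrightarrow> conj_curvature G S k g < 0)"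
proof -
  obtain e :: nat where e: "2 * \<delta> \<le> e" using real_arch_simple by blast
  obtain K where K: "\<And>k. K \<le> k \<Longrightarrow>
      8 * card (word_ball (k - k div 4 + e)) \<le> card (word_sphere G S k)"
    using ball_sphere_ratio[OF vc] by metis
  have "conj_curvature G S k g < 0"
    if k: "K + 2 * e + 1 \<le> k" and g: "g \<in> carrier G" and long: "4 * k < wl g" for k g
  proof -
    let ?X = "word_sphere G S k"
    note ratio = K[of k]
    \<comment> \<open>The ball is nonempty, hence so is the sphere, and the average is a genuine one
      rather than a division by zero.\<close>
    have "\<one> \<in> word_ball (k - k div 4 + e)" by (simp add: word_ball_def)
    then have "card (word_ball (k - k div 4 + e)) \<noteq> 0" by auto
    then have X: "0 < card ?X" using ratio k by linarith
    have sums: "(\<Sum>s\<in>?X. gp s g) \<le> 3 / 8 * k * card ?X"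
      "(\<Sum>s\<in>?X. gp s (inv g)) \<le> 3 / 8 * k * card ?X"
      using sum_gp_le[OF _ _ e ratio] g long k by auto
    have k4: "4 * \<delta> < k" using k e by simp
    \<comment> \<open>Two sums of products, each doubled, cost \<open>3 / 2 * k\<close> on average
      out of \<open>2 * k\<close>; the surplus \<open>k / 2 - 2 * \<delta>\<close> is positive by
      \<open>k4\<close>.\<close>
    have "card ?X * real (wl g) < card ?X * (real (wl g) + 2 * k - 2 * \<delta>) - 3 / 2 * k * card ?X"
    proof -
      have "0 < card ?X * (real k / 2 - 2 * \<delta>)" using X k4 by simp
      then show ?thesis by (simp add: algebra_simps)
    qed
    also have "\<dots> \<le> card ?X * (real (wl g) + 2 * k - 2 * \<delta>)
        - 2 * (\<Sum>s\<in>?X. gp s g) - 2 * (\<Sum>s\<in>?X. gp s (inv g))"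
      using sums by simp
    also have "\<dots> = (\<Sum>s\<in>?X. wl g + 2 * k - 2 * gp s g - 2 * gp s (inv g) - 2 * \<delta>)"
      by (simp add: sum_subtractf sum.distrib sum_distrib_left algebra_simps)
    also have "\<dots> \<le> (\<Sum>s\<in>?X. real (word_dist G S (g \<otimes> s) s))"
      using wl_conjugate_ge[OF g _ _ long]
      by (intro sum_mono) (auto simp: word_dist_def word_sphere_def)
    finally have "real (wl g) < 1 / card ?X * (\<Sum>s\<in>?X. real (word_dist G S (g \<otimes> s) s))"
      using X by (simp add: field_simps)
    then show ?thesis
      using long unfolding conj_curvature_def by (intro divide_neg_pos) auto
  qed
  then show ?thesis by (intro exI[of _ "K + 2 * e + 1"]) auto
qed

end

section \<open>Passage from the four-point condition to products based at
  \<open>\<one>\<close>\<close>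

theorem theorem2:
  fixes G :: "('a, 'b) monoid_scheme" and S :: "'a set"
  assumes "group G"
    and "fin_sym_generating_set G S"
    and "hyperbolic_group G S"
    and "\<not> virtually_cyclic G"
  shows "\<exists>K::nat. K \<ge> 1 \<and>
    (\<forall>k\<ge>K. \<forall>g\<in>carrier G. word_length G S g > 4 * k \<longrightarrow> conj_curvature G S k g < 0)"
proof -
  interpret word_metric_group G S
    using assms(1,2) by (simp add: word_metric_group_def word_metric_group_axioms_def)
  obtain \<delta> where \<delta>: "0 \<le> \<delta>"
    and hyp: "gromov_hyperbolic \<delta> (carrier G) (\<lambda>x y. real (word_dist G S x y))"
    using assms(3) unfolding hyperbolic_group_def by blast
  have gp: "gromov_product (\<lambda>x y. real (word_dist G S x y)) x y \<one>\<^bsub>G\<^esub> = gp x y"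
    if "x \<in> carrier G" "y \<in> carrier G" for x y
    using that dist_sym[of x y] by (simp add: gromov_product_def word_dist_def gp_def)
  interpret hyperbolic_word_group G S \<delta>
  proof
    fix x y z assume xyz: "x \<in> carrier G" "y \<in> carrier G" "z \<in> carrier G"
    then have "min (gp x z) (gp y z) - \<delta> \<le> gp x y"
      using hyp unfolding gromov_hyperbolic_def by (metis gp one_closed)
    then show "min (gp x z) (gp z y) \<le> gp x y + \<delta>"
      using gp_sym[of y z] xyz by simp
  qed (rule \<delta>)
  show ?thesis by (rule eventually_negative_curvature[OF assms(4)])
qed

end
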